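(* Let $S\subseteq\mathbb{R}^m$, $T\subseteq\mathbb{R}^n$, $W\subseteq\mathbb{R}^p$ be equipped with distance functions $\operatorname{dist}_S,\operatorname{dist}_T,\operatorname{dist}_W$, let $h:S\to T$ and $g:T\to W$ be functions, and let $f=g\circ h$. Then for every $x\in S$, $$\tilde\kappa(f,x)\le\tilde\kappa(g,h(x))\,\tilde\kappa(h,x).$$
   Context: A distance function on a set $D\subseteq\mathbb{R}^d$ is a map $\operatorname{dist}_D:D\times D\to[0,\infty]$ (the value $\infty$ is allowed) that is symmetric, satisfies the triangle inequality, and satisfies $\operatorname{dist}_D(x,y)=0\Leftrightarrow x=y$. For a function $f:S\to T$ between sets with distance functions and $x\in S$, the condition number is $$\kappa(f,x)=\lim_{\epsilon\to0}\ \sup_{y\in S,\ 0<\operatorname{dist}_S(x,y)\le\epsilon}\frac{\operatorname{dist}_T(f(x),f(y))}{\operatorname{dist}_S(x,y)}\in[0,\infty],$$ with the convention $\kappa(f,x)=0$ if $x$ is an isolated point of $S$ for the topology induced by $\operatorname{dist}_S$. Moreover $\tilde\kappa(f,x)=1+\kappa(f,x)\in[1,\infty]$. *)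

theory Defs
  imports "HOL-Analysis.Analysis"
begin

definition distance_function_on :: "'a set \<Rightarrow> ('a \<Rightarrow> 'a \<Rightarrow> ennreal) \<Rightarrow> bool" where
  "distance_function_on D d \<longleftrightarrow>
     (\<forall>x\<in>D. \<forall>y\<in>D. d x y = d y x) \<and>
     (\<forall>x\<in>D. \<forall>y\<in>D. \<forall>z\<in>D. d x z \<le> d x y + d y z) \<and>
     (\<forall>x\<in>D. \<forall>y\<in>D. d x y = 0 \<longleftrightarrow> x = y)"

definition dist_topology :: "'a set \<Rightarrow> ('a \<Rightarrow> 'a \<Rightarrow> ennreal) \<Rightarrow> 'a topology" where
  "dist_topology D d =
     topology (\<lambda>U. U \<subseteq> D \<and> (\<forall>x\<in>U. \<exists>r>0. \<forall>y\<in>D. d x y < r \<longrightarrow> y \<in> U))"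

text \<open>The sets in \<^const>\<open>dist_topology\<close> do form a topology, so the abstract type is used properly.\<close>

lemma openin_dist_topology:
  "openin (dist_topology D d) U \<longleftrightarrow>
     U \<subseteq> D \<and> (\<forall>x\<in>U. \<exists>r>0. \<forall>y\<in>D. d x y < r \<longrightarrow> y \<in> U)"
proof -
  let ?P = "\<lambda>U. U \<subseteq> D \<and> (\<forall>x\<in>U. \<exists>r>0. \<forall>y\<in>D. d x y < r \<longrightarrow> y \<in> U)"
  have "?P (U \<inter> V)" if UV: "?P U" "?P V" for U V
  proof (intro conjI ballI)
    show "U \<inter> V \<subseteq> D" using UV by blast
    fix x assume x: "x \<in> U \<inter> V"
    obtain r s where "r > 0" "\<forall>y\<in>D. d x y < r \<longrightarrow> y \<in> U" "s > 0" "\<forall>y\<in>D. d x y < s \<longrightarrow> y \<in> V"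
      using UV x by blast
    then show "\<exists>r>0. \<forall>y\<in>D. d x y < r \<longrightarrow> y \<in> U \<inter> V"
      by (intro exI[of _ "min r s"]) auto
  qed
  moreover have "?P (\<Union>K)" if K: "\<forall>U\<in>K. ?P U" for K
  proof (intro conjI ballI)
    show "\<Union>K \<subseteq> D" using K by blast
    fix x assume "x \<in> \<Union>K"
    then obtain U where U: "U \<in> K" "x \<in> U" by blast
    then obtain r where "r > 0" "\<forall>y\<in>D. d x y < r \<longrightarrow> y \<in> U"
      using K by blast
    with U show "\<exists>r>0. \<forall>y\<in>D. d x y < r \<longrightarrow> y \<in> \<Union>K" by blast
  qed
  ultimately have "istopology ?P"
    unfolding istopology_def by blast
  then show ?thesis
    by (simp add: dist_topology_def)
qed

definition cond_sup ::
  "'a set \<Rightarrow> ('a \<Rightarrow> 'a \<Rightarrow> ennreal) \<Rightarrow> ('b \<Rightarrow> 'b \<Rightarrow> ennreal) \<Rightarrow> ('a \<Rightarrow> 'b) \<Rightarrow> 'a \<Rightarrow> real \<Rightarrow> ennreal"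
  where
  "cond_sup S dS dT f x \<epsilon> =
     (SUP y\<in>{y \<in> S. 0 < dS x y \<and> dS x y \<le> ennreal \<epsilon>}. dT (f x) (f y) / dS x y)"

definition cond_number ::
  "'a set \<Rightarrow> ('a \<Rightarrow> 'a \<Rightarrow> ennreal) \<Rightarrow> ('b \<Rightarrow> 'b \<Rightarrow> ennreal) \<Rightarrow> ('a \<Rightarrow> 'b) \<Rightarrow> 'a \<Rightarrow> ennreal"
  where
  "cond_number S dS dT f x =
     (if openin (dist_topology S dS) {x} then 0
      else Lim (at_right 0) (cond_sup S dS dT f x))"

definition cond_number1 ::
  "'a set \<Rightarrow> ('a \<Rightarrow> 'a \<Rightarrow> ennreal) \<Rightarrow> ('b \<Rightarrow> 'b \<Rightarrow> ennreal) \<Rightarrow> ('a \<Rightarrow> 'b) \<Rightarrow> 'a \<Rightarrow> ennreal"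
  where
  "cond_number1 S dS dT f x = 1 + cond_number S dS dT f x"

text \<open>The limit in \<^const>\<open>cond_number\<close> always exists, because the supremum is monotone in
  \<open>\<epsilon>\<close>; hence \<^const>\<open>Lim\<close> denotes the intended value.\<close>

lemma cond_sup_tendsto:
  "(cond_sup S dS dT f x \<longlongrightarrow> (INF \<epsilon>\<in>{0<..}. cond_sup S dS dT f x \<epsilon>)) (at_right 0)"
proof (rule order_tendstoI)
  fix a assume "a < (INF \<epsilon>\<in>{0<..}. cond_sup S dS dT f x \<epsilon>)"
  then have "a < cond_sup S dS dT f x \<epsilon>" if "\<epsilon> > 0" for \<epsilon>
    using that by (meson INF_lower greaterThan_iff less_le_trans)
  then show "\<forall>\<^sub>F \<epsilon> in at_right 0. a < cond_sup S dS dT f x \<epsilon>"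
    by (auto simp: eventually_at_right_field intro: exI[of _ 1])
next
  fix a assume "(INF \<epsilon>\<in>{0<..}. cond_sup S dS dT f x \<epsilon>) < a"
  then obtain e where e: "e > 0" "cond_sup S dS dT f x e < a"
    by (auto simp: INF_less_iff)
  have "cond_sup S dS dT f x \<epsilon> \<le> cond_sup S dS dT f x e" if "\<epsilon> < e" for \<epsilon>
    unfolding cond_sup_def using that
    by (intro SUP_subset_mono) (auto elim!: order_trans intro!: ennreal_leI)
  with e show "\<forall>\<^sub>F \<epsilon> in at_right 0. cond_sup S dS dT f x \<epsilon> < a"
    by (auto simp: eventually_at_right_field intro!: exI[of _ e] intro: le_less_trans)
qed

end

(* Both condition numbers on the right may be assumed finite, so h is locally Lipschitz at x and maps
   small balls around x to small balls around h x. There the difference quotient of f is the product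
   of those of g and h, hence \<kappa>(f,x) \<le> \<kappa>(g,h x) \<kappa>(h,x). *)
theory Submission imports Defs begin

text \<open>The quotient at \<open>y\<close> is one of those in the supremum. Multiplying back is
  sound because \<open>dS x y\<close> is positive and, being at most a real, finite.\<close>

lemma dist_le_cond_sup_mult:
  assumes "y \<in> S" "0 < dS x y" "dS x y \<le> ennreal \<epsilon>"
  shows "dT (f x) (f y) \<le> cond_sup S dS dT f x \<epsilon> * dS x y"
proof -
  have "dS x y \<noteq> top"
    using assms(3) by (auto simp: top_unique)
  then have "dT (f x) (f y) = dT (f x) (f y) / dS x y * dS x y"
    using assms(2) by (simp add: ennreal_divide_times ennreal_divide_self less_top zero_less_iff_neq_zero)
  also have "\<dots> \<le> cond_sup S dS dT f x \<epsilon> * dS x y"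
    unfolding cond_sup_def using assms by (intro mult_right_mono SUP_upper) auto
  finally show ?thesis .
qed

text \<open>At an isolated point the supremum is eventually taken over the empty set, and
  \<open>Sup {} = 0\<close> in \<^typ>\<open>ennreal\<close> agrees with the convention.\<close>
lemma cond_number_eq_INF:
  assumes "distance_function_on S dS" "x \<in> S"
  shows "cond_number S dS dT f x = (INF \<epsilon>\<in>{0<..}. cond_sup S dS dT f x \<epsilon>)"
proof (cases "openin (dist_topology S dS) {x}")
  case True
  then obtain r where "r > 0" and r: "\<And>y. y \<in> S \<Longrightarrow> dS x y < r \<Longrightarrow> y = x"
    by (auto simp: openin_dist_topology)
  \<comment> \<open>\<open>cond_sup\<close> takes a real radius, while \<open>r\<close> may be
    infinite.\<close>
  obtain e where e: "0 < e" "ennreal e < r"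
  proof -
    obtain q where "0 < q" "q < r"
      using \<open>r > 0\<close> dense by blast
    then show thesis
      using that by (cases q) (auto simp: top_unique)
  qed
  have "dS x x = 0"
    using assms by (simp add: distance_function_on_def)
  then have "{y \<in> S. 0 < dS x y \<and> dS x y \<le> ennreal e} = {}"
    using r e(2) by (auto dest: le_less_trans)
  then have "cond_sup S dS dT f x e = 0"
    by (simp only: cond_sup_def image_empty Sup_empty bot_ennreal)
  then have "(INF \<epsilon>\<in>{0<..}. cond_sup S dS dT f x \<epsilon>) \<le> 0"
    using e(1) by (metis INF_lower greaterThan_iff)
  with True show ?thesis
    by (simp add: cond_number_def)
next
  case False
  then show ?thesis
    by (simp add: cond_number_def tendsto_Lim[OF _ cond_sup_tendsto])
qed

text \<open>A finite supremum for \<open>h\<close> is a Lipschitz constant at \<open>x\<close>. On a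
  small enough ball \<open>h\<close> therefore stays within \<delta> of \<open>h x\<close>, where
  the bound for \<open>g\<close> applies.\<close>

lemma cond_sup_comp_le:
  assumes "distance_function_on T dT" "distance_function_on W dW"
    and "h \<in> S \<rightarrow> T" "g \<in> T \<rightarrow> W" "\<And>y. y \<in> S \<Longrightarrow> f y = g (h y)" "x \<in> S"
    and "\<delta> > 0" "e > 0" and fin: "cond_sup S dS dT h x e < top"
  obtains \<epsilon> where "\<epsilon> > 0"
    "cond_sup S dS dW f x \<epsilon> \<le> cond_sup T dT dW g (h x) \<delta> * cond_sup S dS dT h x e"
proof -
  let ?G = "cond_sup T dT dW g (h x) \<delta>" and ?H = "cond_sup S dS dT h x e"
  obtain M where M: "?H = ennreal M" "M \<ge> 0"
    using fin by (cases ?H) auto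
  \<comment> \<open>The bound \<open>e\<close> keeps the Lipschitz estimate for \<open>h\<close>
    valid; the other bound gives \<open>M * \<epsilon> \<le> \<delta>\<close>, with
    \<open>M + 1\<close> guarding against \<open>M = 0\<close>.\<close>
  define \<epsilon> where "\<epsilon> = min e (\<delta> / (M + 1))"
  have \<epsilon>: "\<epsilon> > 0" "\<epsilon> \<le> e"
    using assms(7,8) M by (auto simp: \<epsilon>_def)
  have "M * \<epsilon> \<le> (M + 1) * (\<delta> / (M + 1))"
    unfolding \<epsilon>_def using M assms(7,8) by (intro mult_mono) auto
  then have M\<epsilon>: "M * \<epsilon> \<le> \<delta>"
    using M by simp
  have "dW (f x) (f y) / dS x y \<le> ?G * ?H"
    if y: "y \<in> S" "0 < dS x y" "dS x y \<le> ennreal \<epsilon>" for y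
  proof -
    have hT: "h x \<in> T" "h y \<in> T"
      using assms y by auto
    have "dS x y \<le> ennreal e"
      using y(3) \<epsilon>(2) by (meson ennreal_leI order_trans)
    then have dT: "dT (h x) (h y) \<le> ?H * dS x y"
      by (intro dist_le_cond_sup_mult y)
    also have "\<dots> \<le> ennreal M * ennreal \<epsilon>"
      unfolding M by (intro mult_left_mono y) auto
    also have "\<dots> \<le> ennreal \<delta>"
      using M M\<epsilon> \<epsilon> by (simp add: ennreal_mult[symmetric] ennreal_leI)
    finally have \<delta>: "dT (h x) (h y) \<le> ennreal \<delta>" .
    have "dW (g (h x)) (g (h y)) \<le> ?G * dT (h x) (h y)"
    \<comment> \<open>The supremum \<open>?G\<close> ranges over positive distances only, so
      coinciding images are treated apart; there both sides vanish.\<close>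
    proof (cases "h x = h y")
      case True
      then have "dW (g (h x)) (g (h y)) = 0"
        using assms(2) funcset_mem[OF assms(4) hT(2)] by (simp add: distance_function_on_def)
      then show ?thesis by simp
    next
      case False
      then have "dT (h x) (h y) \<noteq> 0"
        using assms(1) hT by (auto simp: distance_function_on_def)
      then show ?thesis
        using \<delta> hT by (intro dist_le_cond_sup_mult) (auto simp: zero_less_iff_neq_zero)
    qed
    also have "\<dots> \<le> ?G * (?H * dS x y)"
      by (intro mult_left_mono dT) auto
    finally have "dW (f x) (f y) \<le> (?G * ?H) * dS x y"
      using assms(5,6) y(1) by (simp add: mult.assoc)
    then have "dW (f x) (f y) / dS x y \<le> (?G * ?H) * dS x y / dS x y"
      by (rule divide_right_mono_ennreal)
    also have "\<dots> = ?G * ?H"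
      using y by (intro ennreal_mult_divide_eq) (auto simp: top_unique)
    finally show ?thesis .
  qed
  then have "cond_sup S dS dW f x \<epsilon> \<le> ?G * ?H"
    unfolding cond_sup_def[of S dS dW] by (intro SUP_least) auto
  with \<epsilon>(1) that show thesis by blast
qed

text \<open>The product of the two suprema at a common radius bounds \<kappa>(f,x); letting the
  radius tend to 0 gives the claim.\<close>

lemma cond_number_comp_le:
  assumes S: "distance_function_on S dS" and T: "distance_function_on T dT"
    and W: "distance_function_on W dW"
    and h: "h \<in> S \<rightarrow> T" and g: "g \<in> T \<rightarrow> W" and f: "\<And>y. y \<in> S \<Longrightarrow> f y = g (h y)"
    and x: "x \<in> S"
    and fin: "cond_number T dT dW g (h x) < top" "cond_number S dS dT h x < top"
  shows "cond_number S dS dW f x \<le> cond_number T dT dW g (h x) * cond_number S dS dT h x"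
proof -
  let ?G = "cond_sup T dT dW g (h x)" and ?H = "cond_sup S dS dT h x"
  have hx: "h x \<in> T"
    using h x by auto
  have G: "(?G \<longlongrightarrow> cond_number T dT dW g (h x)) (at_right 0)"
    unfolding cond_number_eq_INF[OF T hx] by (rule cond_sup_tendsto)
  have H: "(?H \<longlongrightarrow> cond_number S dS dT h x) (at_right 0)"
    unfolding cond_number_eq_INF[OF S x] by (rule cond_sup_tendsto)
  \<comment> \<open>Finite limits exclude the pair of 0 and \<open>top\<close>, where multiplication
    on \<open>ennreal\<close> is not continuous.\<close>
  have "((\<lambda>\<epsilon>. ?G \<epsilon> * ?H \<epsilon>) \<longlongrightarrow>
      cond_number T dT dW g (h x) * cond_number S dS dT h x) (at_right 0)"
    using fin by (intro tendsto_mult_ennreal G H) auto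
  \<comment> \<open>As \<kappa>(f,x) is an infimum over radii, a single radius
    \<open>\<epsilon>'\<close> suffices. It exists once \<open>?H \<epsilon>\<close> is finite, with
    \<epsilon> serving as both radii \<delta> and \<open>e\<close>.\<close>
  moreover have "\<forall>\<^sub>F \<epsilon> in at_right 0. cond_number S dS dW f x \<le> ?G \<epsilon> * ?H \<epsilon>"
    using order_tendstoD(2)[OF H fin(2)] eventually_at_right_less
  proof eventually_elim
    case (elim \<epsilon>)
    obtain \<epsilon>' where "\<epsilon>' > 0" "cond_sup S dS dW f x \<epsilon>' \<le> ?G \<epsilon> * ?H \<epsilon>"
      using cond_sup_comp_le[OF T W h g f x elim(2,2,1)] by blast
    then show ?case
      unfolding cond_number_eq_INF[OF S x] by (meson INF_lower2 greaterThan_iff)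
  qed
  ultimately show ?thesis
    by (rule tendsto_lowerbound) simp
qed

theorem lemma3p2:
  fixes S :: "(real ^ 'm) set" and T :: "(real ^ 'n) set" and W :: "(real ^ 'p) set"
    and dist_S :: "real ^ 'm \<Rightarrow> real ^ 'm \<Rightarrow> ennreal"
    and dist_T :: "real ^ 'n \<Rightarrow> real ^ 'n \<Rightarrow> ennreal"
    and dist_W :: "real ^ 'p \<Rightarrow> real ^ 'p \<Rightarrow> ennreal"
    and h :: "real ^ 'm \<Rightarrow> real ^ 'n" and g :: "real ^ 'n \<Rightarrow> real ^ 'p"
    and f :: "real ^ 'm \<Rightarrow> real ^ 'p"
  assumes "distance_function_on S dist_S"
    and "distance_function_on T dist_T"
    and "distance_function_on W dist_W"
    and "h \<in> S \<rightarrow> T" and "g \<in> T \<rightarrow> W"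
    and "\<And>x. x \<in> S \<Longrightarrow> f x = (g \<circ> h) x"
    and "x \<in> S"
  shows "cond_number1 S dist_S dist_W f x
           \<le> cond_number1 T dist_T dist_W g (h x) * cond_number1 S dist_S dist_T h x"
proof (cases "cond_number T dist_T dist_W g (h x) < top \<and> cond_number S dist_S dist_T h x < top")
  case True
  let ?G = "cond_number T dist_T dist_W g (h x)" and ?H = "cond_number S dist_S dist_T h x"
  have "cond_number S dist_S dist_W f x \<le> ?G * ?H"
    using True assms by (intro cond_number_comp_le[of S dist_S T dist_T W]) auto
  then have "1 + cond_number S dist_S dist_W f x \<le> 1 + ?G * ?H"
    by (rule add_left_mono)
  \<comment> \<open>Adding the cross terms completes the product of the two factors.\<close>
  also have "\<dots> \<le> (1 + ?G * ?H) + (?G + ?H)"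
    by simp
  also have "\<dots> = (1 + ?G) * (1 + ?H)"
    by (simp add: algebra_simps)
  finally show ?thesis
    by (simp add: cond_number1_def)
next
  case False
  \<comment> \<open>One factor is infinite and the other is at least 1, so the product is
    \<open>top\<close>. Without the added 1 it could be \<open>top * 0 = 0\<close>.\<close>
  then show ?thesis
    by (auto simp: cond_number1_def less_top[symmetric] ennreal_top_mult ennreal_mult_top)
qed

end
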